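(* Let $m_v>0$ and let $M$ be the $2n\times2n$ symmetric matrix given by $$(M\mathbf u)_i=\Delta x\, m_v\left(-\tfrac12u_{i-1/2}+u_i-\tfrac12u_{i+1/2}\right),$$ $$(M\mathbf u)_{i+1/2}=\Delta x\, m_v\left(\tfrac16u_{i-1/2}-\tfrac12u_i+\tfrac23u_{i+1/2}-\tfrac12u_{i+1}+\tfrac16u_{i+3/2}\right).$$ Then $M$ is positive semidefinite with an eigenvalue $0$ of multiplicity $1$ and corresponding eigenvector $\mathbf 1$.
   Context: Uniform periodic grid with $n$ cells of size $\Delta x>0$. The unknowns are cell averages $u_i$ and interface point values $u_{i+1/2}$, with $u_{i+n}=u_i$, $u_{i+n+1/2}=u_{i+1/2}$ (cell indices modulo $n$), collected in $\mathbf u=(u_{-1/2},u_0,u_{1/2},u_1,\dots,u_{n-3/2},u_{n-1})^T\in\mathbb R^{2n}$. $(M\mathbf u)_i$ and $(M\mathbf u)_{i+1/2}$ denote the components of $M\mathbf u$ at the positions of $u_i$ and $u_{i+1/2}$. $\mathbf 1$ is the all-ones vector. *)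

theory Defs
  imports "Jordan_Normal_Form.Char_Poly"
begin

text \<open>
  A vector of length \<open>2 * n\<close> stores the unknowns in the order
  \<open>u(-1/2), u(0), u(1/2), u(1), \<dots>, u(n-3/2), u(n-1)\<close>, so the cell average \<open>u(i)\<close> is the entry
  \<open>2 * i + 1\<close> and the point value \<open>u(i-1/2)\<close> is the entry \<open>2 * i\<close>, for \<open>0 \<le> i < n\<close>.
  Reducing the integer index modulo \<open>n\<close> makes both families periodic.
\<close>

definition cell :: "nat \<Rightarrow> real vec \<Rightarrow> int \<Rightarrow> real" where
  "cell n u i = u $ nat (2 * (i mod int n) + 1)"

text \<open>\<open>iface n u i\<close> is the value at the right interface of cell \<open>i\<close>, i.e. \<open>u(i+1/2)\<close>;
  hence \<open>u(i-1/2)\<close> is \<open>iface n u (i - 1)\<close>.\<close>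

definition iface :: "nat \<Rightarrow> real vec \<Rightarrow> int \<Rightarrow> real" where
  "iface n u i = u $ nat (2 * ((i + 1) mod int n))"

definition ones_vec :: "nat \<Rightarrow> real vec" where
  "ones_vec N = vec N (\<lambda>_. 1)"

definition symmetric_matrix :: "real mat \<Rightarrow> bool" where
  "symmetric_matrix A \<longleftrightarrow> square_mat A \<and> transpose_mat A = A"

definition positive_semidefinite :: "real mat \<Rightarrow> bool" where
  "positive_semidefinite A \<longleftrightarrow>
     symmetric_matrix A \<and> (\<forall>x \<in> carrier_vec (dim_row A). 0 \<le> x \<bullet> (A *\<^sub>v x))"

end

theory Submission
  imports Defs
begin

text \<open>
  Up to the factor \<open>dx * m_v\<close>, the bilinear form of \<open>M\<close> is a sum over the cells of two rank-one forms.
  Write \<open>a\<close> and \<open>b\<close> for the values of \<open>u\<close> at the left and right interface of a cell. The row of the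
  cell average \<open>u\<^sub>i\<close> involves only the deviation \<open>u\<^sub>i - (a + b) / 2\<close> of the average from the mean of the
  two neighbouring point values. Completing the square in this deviation leaves a form in
  the point values alone, which is \<open>(b - a)\<^sup>2 / 12\<close> per cell. This requires sharing
  the terms of each point value row between the two adjacent cells; on a periodic grid such a regrouping
  changes the sum over all cells only by a telescoping sum that vanishes. The resulting identity
  \<open>bilinear_form\<close> gives symmetry and positive semidefiniteness at once. It also gives the kernel:
  if both squares vanish in every cell, then all point values agree, and every cell average equals
  them, so the kernel is spanned by the all-ones vector.

  It remains to pass from the one-dimensional kernel to the algebraic multiplicity, i.e. to the order
  of \<open>0\<close> as a root of the characteristic polynomial. No diagonalisation is needed. If \<open>A v = 0\<close>, a change of
  basis that makes \<open>v\<close> a basis vector turns one column of \<open>A\<close> into zero, so that the characteristic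
  polynomial is \<open>X\<close> times that of a smaller matrix \<open>C\<close>. A kernel vector of \<open>C\<close> would give a
  vector outside the span of \<open>v\<close> that \<open>A\<close> maps into the span of \<open>v\<close>, hence that \<open>A\<^sup>2\<close> annihilates.
  For symmetric \<open>A\<close> the kernels of \<open>A\<^sup>2\<close> and \<open>A\<close> coincide, which excludes this. These two steps are
  \<open>order_char_poly_simple_kernel\<close> and \<open>order_char_poly_symmetric\<close>.
\<close>

section \<open>Algebraic simplicity of the eigenvalue zero\<close>

definition replace_col :: "nat \<Rightarrow> nat \<Rightarrow> 'a :: field vec \<Rightarrow> 'a mat" where
  "replace_col n k v = mat n n (\<lambda>(i,j). if j = k then v $ i else if i = j then 1 else 0)"

lemma replace_col_mult_vec:
  fixes v w :: "'a :: field vec"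
  assumes "v \<in> carrier_vec n" "w \<in> carrier_vec n" "k < n"
  shows "replace_col n k v *\<^sub>v w
    = vec n (\<lambda>i. v $ i * w $ k + (if i = k then 0 else w $ i))"
proof (rule eq_vecI)
  fix i assume "i < dim_vec (vec n (\<lambda>i. v $ i * w $ k + (if i = k then 0 else w $ i)))"
  then have "i < n" by simp
  have "(\<Sum>j\<in>{0..<n}. (if j = k then v $ i else if i = j then 1 else 0) * w $ j)
      = v $ i * w $ k + (\<Sum>j\<in>{0..<n} - {k}. (if j = k then v $ i else if i = j then 1 else 0) * w $ j)"
    using assms(3) by (subst sum.remove[of _ k]) auto
  also have "(\<Sum>j\<in>{0..<n} - {k}. (if j = k then v $ i else if i = j then 1 else 0) * w $ j)
      = (\<Sum>j\<in>{0..<n} - {k}. if i = j then w $ j else 0)"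
    by (intro sum.cong) auto
  also have "\<dots> = (if i = k then 0 else w $ i)"
    using \<open>i < n\<close> by (simp add: sum.delta)
  finally show "(replace_col n k v *\<^sub>v w) $ i
    = vec n (\<lambda>i. v $ i * w $ k + (if i = k then 0 else w $ i)) $ i"
    using \<open>i < n\<close> assms by (simp add: replace_col_def scalar_prod_def)
qed (simp add: replace_col_def)

lemma replace_col_carrier [simp]: "replace_col n k v \<in> carrier_mat n n"
  by (simp add: replace_col_def)

lemma col_replace_col:
  assumes "v \<in> carrier_vec n" "j < n"
  shows "col (replace_col n k v) j = (if j = k then v else unit_vec n j)"
  using assms by (auto simp: replace_col_def intro!: eq_vecI)

text \<open>
  Replacing a column of the identity is an elementary elimination step, and it is undone by another one:
  \<open>u\<close> is the unique vector with \<open>replace_col n k v *\<^sub>v u = unit_vec n k\<close>.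
\<close>
lemma replace_col_inverse:
  fixes v :: "'a :: field vec"
  assumes "v \<in> carrier_vec n" "k < n" "v $ k \<noteq> 0"
  defines "u \<equiv> vec n (\<lambda>i. if i = k then 1 / v $ k else - v $ i / v $ k)"
  shows "replace_col n k v * replace_col n k u = 1\<^sub>m n"
    and "replace_col n k u * replace_col n k v = 1\<^sub>m n"
proof -
  have u: "u \<in> carrier_vec n" by (simp add: u_def)
  have *: "replace_col n k x * replace_col n k y = 1\<^sub>m n"
    if x: "x \<in> carrier_vec n" and y: "y \<in> carrier_vec n"
      and xy: "\<And>i. i < n \<Longrightarrow> x $ i * y $ k + (if i = k then 0 else y $ i) = (if i = k then 1 else 0)"
    for x y :: "'a vec"
  proof (rule eq_matI)
    fix i j assume ij: "i < dim_row (1\<^sub>m n :: 'a mat)" "j < dim_col (1\<^sub>m n :: 'a mat)"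
    have "(replace_col n k x * replace_col n k y) $$ (i, j)
        = (replace_col n k x *\<^sub>v col (replace_col n k y) j) $ i"
      using ij by (simp add: replace_col_def)
    also have "\<dots> = (if i = j then 1 else 0)"
      using ij x y xy[of i] \<open>k < n\<close>
      by (cases "j = k") (auto simp: col_replace_col replace_col_mult_vec)
    finally show "(replace_col n k x * replace_col n k y) $$ (i, j) = 1\<^sub>m n $$ (i, j)"
      using ij by simp
  qed (simp_all add: replace_col_def)
  show "replace_col n k v * replace_col n k u = 1\<^sub>m n"
    using assms u by (intro *) (auto simp: field_simps u_def)
  show "replace_col n k u * replace_col n k v = 1\<^sub>m n"
    using assms u by (intro *) (auto simp: field_simps u_def)
qed

lemma mult_unit_vec:
  fixes A :: "'a :: comm_ring_1 mat"
  assumes "A \<in> carrier_mat m n" "k < n"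
  shows "A *\<^sub>v unit_vec n k = col A k"
  using assms by (intro eq_vecI) auto

lemma mult_zero_vec:
  fixes A :: "'a :: comm_ring_1 mat"
  assumes "A \<in> carrier_mat m n"
  shows "A *\<^sub>v 0\<^sub>v n = 0\<^sub>v m"
  using assms by (intro eq_vecI) auto

text \<open>
  Deleting row and column \<open>k\<close> is compatible with multiplication for vectors that vanish at \<open>k\<close>,
  since the deleted column then contributes nothing.
\<close>
lemma mult_vec_zero_extend:
  fixes B :: "'a :: comm_ring_1 mat"
  assumes B: "B \<in> carrier_mat n n" and k: "k < n" and w: "w \<in> carrier_vec n" and wk: "w $ k = 0"
    and i: "i < n - 1"
  shows "(mat_delete B k k *\<^sub>v vec (n - 1) (\<lambda>j. w $ insert_index k j)) $ i
      = (B *\<^sub>v w) $ insert_index k i"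
proof -
  have n: "Suc (n - 1) = n" using k by simp
  have ins: "insert_index k j < n" if "j < n - 1" for j
    using that k by (auto simp: insert_index_def)
  have "(mat_delete B k k *\<^sub>v vec (n - 1) (\<lambda>j. w $ insert_index k j)) $ i
      = (\<Sum>j\<in>{0..<n - 1}. mat_delete B k k $$ (i, j) * w $ insert_index k j)"
    using B i by (simp add: scalar_prod_def row_def)
  also have "\<dots> = (\<Sum>j\<in>{0..<n - 1}. B $$ (insert_index k i, insert_index k j) * w $ insert_index k j)"
    using B i k by (intro sum.cong) (auto simp: mat_delete_def insert_index_def)
  also have "\<dots> = (\<Sum>j\<in>{0..<n} - {k}. B $$ (insert_index k i, j) * w $ j)"
    using insert_index_image[of k "n - 1"] k sum.reindex[OF insert_index_inj_on[of k "{0..<n - 1}"],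
      of "\<lambda>j. B $$ (insert_index k i, j) * w $ j"]
    by (simp add: n o_def)
  also have "\<dots> = (\<Sum>j\<in>{0..<n}. B $$ (insert_index k i, j) * w $ j)"
    using k wk by (subst sum.remove[of _ k]) auto
  also have "\<dots> = (B *\<^sub>v w) $ insert_index k i"
    using B w ins[OF i] by (simp add: scalar_prod_def row_def)
  finally show ?thesis .
qed

text \<open>
  The hypothesis on \<open>A\<^sup>2\<close> says that there is no Jordan chain of length two above \<open>v\<close>, besides the
  kernel being one-dimensional; with the kernel of \<open>A\<close> alone the conclusion fails for a nilpotent Jordan block.
\<close>
lemma order_char_poly_simple_kernel:
  fixes A :: "'a :: field mat"
  assumes A: "A \<in> carrier_mat n n" and v: "v \<in> carrier_vec n" "v \<noteq> 0\<^sub>v n"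
    and Av: "A *\<^sub>v v = 0\<^sub>v n"
    and ker: "\<And>w. w \<in> carrier_vec n \<Longrightarrow> A *\<^sub>v (A *\<^sub>v w) = 0\<^sub>v n \<Longrightarrow> \<exists>d. w = d \<cdot>\<^sub>v v"
  shows "Polynomial.order 0 (char_poly A) = 1"
proof -
  from v obtain k where k: "k < n" "v $ k \<noteq> 0"
    by (metis carrier_vecD eq_vecI index_zero_vec)
  define u where "u = vec n (\<lambda>i. if i = k then 1 / v $ k else - v $ i / v $ k)"
  define P Q where "P = replace_col n k v" and "Q = replace_col n k u"
  have P: "P \<in> carrier_mat n n" and Q: "Q \<in> carrier_mat n n" by (simp_all add: P_def Q_def)
  have PQ: "P * Q = 1\<^sub>m n" "Q * P = 1\<^sub>m n"
    using replace_col_inverse[OF v(1) k] by (simp_all add: P_def Q_def u_def)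
  have Pek: "P *\<^sub>v unit_vec n k = v"
    using mult_unit_vec[OF P k(1)] col_replace_col[OF v(1) k(1)] by (simp add: P_def)
  \<comment> \<open>In the new basis, \<open>v\<close> is the basis vector \<open>k\<close>, so column \<open>k\<close> of the transformed matrix is zero.\<close>
  define B where "B = Q * A * P"
  have B: "B \<in> carrier_mat n n" using A P Q by (simp add: B_def)
  have APB: "P * B = A * P"
  proof -
    have "P * B = (P * Q) * (A * P)" using A P Q unfolding B_def by (simp add: assoc_mult_mat[of _ n n _ n _ n])
    then show ?thesis using A P by (simp add: PQ)
  qed
  have "A = P * B * Q"
    using A P Q PQ by (simp add: APB assoc_mult_mat[of _ n n _ n _ n])
  then have sim: "char_poly A = char_poly B"
    using A B P Q PQ by (intro char_poly_similar similar_matI[of _ _ P Q n]) auto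
  have col0: "B $$ (j, k) = 0" if "j < n" for j
  proof -
    have "col B k = B *\<^sub>v unit_vec n k" using mult_unit_vec[OF B k(1)] by simp
    also have "\<dots> = Q *\<^sub>v (A *\<^sub>v (P *\<^sub>v unit_vec n k))"
      using A P Q unfolding B_def by (simp add: assoc_mult_mat_vec[of _ n n _ n])
    also have "\<dots> = 0\<^sub>v n" using Q by (simp add: Pek Av mult_zero_vec)
    finally show ?thesis using B k(1) that by (metis carrier_matD index_col index_zero_vec(1))
  qed
  define C where "C = mat_delete B k k"
  have C: "C \<in> carrier_mat (n - 1) (n - 1)" unfolding C_def by (rule mat_delete_carrier[OF B])
  have cp: "char_poly A = monom 1 1 * char_poly C"
    unfolding sim C_def by (rule char_poly_0_column[OF col0 B k(1)])
  \<comment> \<open>A kernel vector of \<open>C\<close>, extended by zero and mapped back by \<open>P\<close>, lies in the kernel of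
    \<open>A\<^sup>2\<close> but is independent of \<open>v\<close>.\<close>
  have "poly (char_poly C) 0 \<noteq> 0"
  proof
    assume "poly (char_poly C) 0 = 0"
    moreover have "0 \<cdot>\<^sub>v y = 0\<^sub>v (n - 1)" if "y \<in> carrier_vec (n - 1)" for y :: "'a vec"
      using that by (intro eq_vecI) auto
    ultimately obtain x where x: "x \<in> carrier_vec (n - 1)" "x \<noteq> 0\<^sub>v (n - 1)" and Cx: "C *\<^sub>v x = 0\<^sub>v (n - 1)"
      using eigenvalue_root_char_poly[OF C, of 0] C
      by (auto simp: eigenvalue_def eigenvector_def)
    define w where "w = vec n (\<lambda>i. if i = k then 0 else x $ delete_index k i)"
    have w: "w \<in> carrier_vec n" "w $ k = 0" using k by (simp_all add: w_def)
    have xw: "x = vec (n - 1) (\<lambda>j. w $ insert_index k j)"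
      using x(1) by (intro eq_vecI) (auto simp: w_def insert_index_def delete_index_def)
    have Bw: "(B *\<^sub>v w) $ insert_index k i = 0" if "i < n - 1" for i
      using mult_vec_zero_extend[OF B k(1) w that] that
      unfolding xw[symmetric] C_def[symmetric] Cx by simp
    have "B *\<^sub>v w = (B *\<^sub>v w) $ k \<cdot>\<^sub>v unit_vec n k"
    proof (rule eq_vecI)
      fix i assume "i < dim_vec ((B *\<^sub>v w) $ k \<cdot>\<^sub>v unit_vec n k)"
      then have i: "i < n" by simp
      show "(B *\<^sub>v w) $ i = ((B *\<^sub>v w) $ k \<cdot>\<^sub>v unit_vec n k) $ i"
      proof (cases "i = k")
        case False
        then have "insert_index k (delete_index k i) = i" "delete_index k i < n - 1"
          using i k(1) by (auto simp: insert_index_def delete_index_def)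
        with Bw[of "delete_index k i"] False i k(1) show ?thesis by simp
      qed (use i in simp)
    qed (use B in simp)
    then obtain c where c: "B *\<^sub>v w = c \<cdot>\<^sub>v unit_vec n k" ..
    have "A *\<^sub>v (P *\<^sub>v w) = P *\<^sub>v (B *\<^sub>v w)"
      using A B P w by (metis APB assoc_mult_mat_vec)
    also have "\<dots> = c \<cdot>\<^sub>v v" using P by (simp add: c mult_mat_vec Pek)
    finally have "A *\<^sub>v (A *\<^sub>v (P *\<^sub>v w)) = 0\<^sub>v n"
      using A v by (simp add: mult_mat_vec Av) (auto intro!: eq_vecI)
    then obtain d where d: "P *\<^sub>v w = d \<cdot>\<^sub>v v" using ker[of "P *\<^sub>v w"] P w by auto
    have "w = Q *\<^sub>v (P *\<^sub>v w)"
      using P Q w by (metis PQ(2) assoc_mult_mat_vec one_mult_mat_vec)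
    also have "\<dots> = Q *\<^sub>v (P *\<^sub>v (d \<cdot>\<^sub>v unit_vec n k))"
      using P by (simp add: d mult_mat_vec Pek)
    also have "\<dots> = d \<cdot>\<^sub>v unit_vec n k"
      using P Q by (metis PQ(2) assoc_mult_mat_vec one_mult_mat_vec smult_carrier_vec unit_vec_carrier)
    finally have "w = d \<cdot>\<^sub>v unit_vec n k" .
    then have "w $ insert_index k i = 0" if "i < n - 1" for i
      using that k(1) by (simp add: insert_index_def)
    then have "x = 0\<^sub>v (n - 1)" by (subst xw) (auto intro!: eq_vecI)
    with x(2) show False ..
  qed
  then have "char_poly C \<noteq> 0" "Polynomial.order 0 (char_poly C) = 0"
    by (auto intro: order_0I)
  then show ?thesis
    unfolding cp by (subst order_mult) auto
qed

text \<open>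
  For symmetric \<open>A\<close>, \<open>A (A w) = 0\<close> gives \<open>(A w) \<bullet> (A w) = w \<bullet> (A (A w)) = 0\<close>, hence \<open>A w = 0\<close>, so
  controlling the kernel itself is enough.
\<close>
lemma order_char_poly_symmetric:
  fixes A :: "real mat"
  assumes A: "A \<in> carrier_mat n n" and sym: "transpose_mat A = A"
    and v: "v \<in> carrier_vec n" "v \<noteq> 0\<^sub>v n" and Av: "A *\<^sub>v v = 0\<^sub>v n"
    and ker: "\<And>w. w \<in> carrier_vec n \<Longrightarrow> A *\<^sub>v w = 0\<^sub>v n \<Longrightarrow> \<exists>d. w = d \<cdot>\<^sub>v v"
  shows "Polynomial.order 0 (char_poly A) = 1"
proof (rule order_char_poly_simple_kernel[OF A v Av])
  fix w :: "real vec" assume w: "w \<in> carrier_vec n" and AAw: "A *\<^sub>v (A *\<^sub>v w) = 0\<^sub>v n"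
  have Aw: "A *\<^sub>v w \<in> carrier_vec n" using A w by simp
  have "(A *\<^sub>v w) \<bullet> (A *\<^sub>v w) = w \<bullet> (A *\<^sub>v (A *\<^sub>v w))"
    using transpose_vec_mult_scalar[OF A Aw w] by (simp add: sym)
  also have "\<dots> = 0" using w by (simp add: AAw)
  finally have "(A *\<^sub>v w) \<bullet>c (A *\<^sub>v w) = 0" by simp
  then have "A *\<^sub>v w = 0\<^sub>v n" using conjugate_square_eq_0_vec[OF Aw] by simp
  then show "\<exists>d. w = d \<cdot>\<^sub>v v" using ker[OF w] by blast
qed

section \<open>Cell averages and point values on the periodic grid\<close>

lemma cell_periodic: "cell n u (i + int n) = cell n u i"
  by (simp add: cell_def)

lemma iface_periodic: "iface n u (i + int n) = iface n u i"
  by (simp add: iface_def add.assoc add.commute[of "int n" 1]) (simp flip: add.assoc)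

lemma cell_entry: "i < n \<Longrightarrow> cell n u (int i) = u $ (2 * i + 1)"
  by (simp add: cell_def nat_add_distrib nat_mult_distrib)

lemma iface_entry: "i < n \<Longrightarrow> iface n u (int i - 1) = u $ (2 * i)"
  by (simp add: iface_def nat_mult_distrib)

lemma grid_vec_eqI:
  assumes "u \<in> carrier_vec (2 * n)" "v \<in> carrier_vec (2 * n)"
    and cell_eq: "\<And>i. i < n \<Longrightarrow> cell n u (int i) = cell n v (int i)"
    and iface_eq: "\<And>i. i < n \<Longrightarrow> iface n u (int i - 1) = iface n v (int i - 1)"
  shows "u = v"
proof (rule eq_vecI)
  fix j assume "j < dim_vec v"
  then have j: "j div 2 < n" using assms(2) by auto
  show "u $ j = v $ j"
  proof (cases "even j")
    case True
    then show ?thesis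
      using iface_eq[OF j] iface_entry[OF j, of u] iface_entry[OF j, of v] by simp
  next
    case False
    then have "2 * (j div 2) + 1 = j" by presburger
    then show ?thesis
      using cell_eq[OF j] cell_entry[OF j, of u] cell_entry[OF j, of v] by simp
  qed
qed (use assms in simp)

lemma
  assumes "n \<ge> 1"
  shows cell_const: "cell n (vec (2 * n) (\<lambda>_. t)) i = t"
    and iface_const: "iface n (vec (2 * n) (\<lambda>_. t)) i = t"
proof -
  have "0 \<le> k mod int n \<and> k mod int n < int n" for k using assms by simp
  from this[of i] this[of "i + 1"]
  have "nat (2 * (i mod int n) + 1) < 2 * n" "nat (2 * ((i + 1) mod int n)) < 2 * n"
    by linarith+
  then show "cell n (vec (2 * n) (\<lambda>_. t)) i = t" "iface n (vec (2 * n) (\<lambda>_. t)) i = t"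
    by (simp_all add: cell_def iface_def)
qed

lemma scalar_prod_grid:
  assumes "v \<in> carrier_vec (2 * n)"
  shows "u \<bullet> v = (\<Sum>i<n. iface n u (int i - 1) * iface n v (int i - 1)
    + cell n u (int i) * cell n v (int i))"
proof -
  have "u \<bullet> v = (\<Sum>j<2 * n. u $ j * v $ j)"
    using assms by (simp add: scalar_prod_def lessThan_atLeast0)
  also have "\<dots> = (\<Sum>i<n. u $ (2 * i) * v $ (2 * i) + u $ (2 * i + 1) * v $ (2 * i + 1))"
    by (induction n) simp_all
  also have "\<dots> = (\<Sum>i<n. iface n u (int i - 1) * iface n v (int i - 1)
      + cell n u (int i) * cell n v (int i))"
    by (intro sum.cong) (simp_all add: iface_entry cell_entry)
  finally show ?thesis .
qed

lemma sum_differences_periodic: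
  fixes g :: "int \<Rightarrow> real"
  assumes "\<And>i. g (i + int n) = g i"
  shows "(\<Sum>i<n. g (int i) - g (int i - 1)) = 0"
proof -
  have "(\<Sum>i<m. g (int i) - g (int i - 1)) = g (int m - 1) - g (- 1)" for m
    by (induction m) simp_all
  then show ?thesis using assms[of "- 1"] by (simp add: add.commute)
qed

section \<open>The energy identity for the matrix\<close>

text \<open>The factor \<open>c\<close> stands for \<open>dx * m_v\<close>.\<close>
locale periodic_stencil_matrix =
  fixes n :: nat and c :: real and M :: "real mat"
  assumes n_pos: "n \<ge> 1" and c_pos: "c > 0"
    and M: "M \<in> carrier_mat (2 * n) (2 * n)"
    and cell_M: "\<And>u i. u \<in> carrier_vec (2 * n) \<Longrightarrow>
      cell n (M *\<^sub>v u) i = c * (- (1/2) * iface n u (i - 1) + cell n u i - (1/2) * iface n u i)"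
    and iface_M: "\<And>u i. u \<in> carrier_vec (2 * n) \<Longrightarrow>
      iface n (M *\<^sub>v u) i =
        c * ((1/6) * iface n u (i - 1) - (1/2) * cell n u i + (2/3) * iface n u i
          - (1/2) * cell n u (i + 1) + (1/6) * iface n u (i + 1))"
begin

definition deviation :: "real vec \<Rightarrow> int \<Rightarrow> real" where
  "deviation u i = cell n u i - (iface n u (i - 1) + iface n u i) / 2"

definition jump :: "real vec \<Rightarrow> int \<Rightarrow> real" where
  "jump u i = iface n u i - iface n u (i - 1)"

text \<open>
  Each cell contributes one product of deviations and one product of jumps. The identity is stated
  for two vectors, not only as a quadratic form, so that symmetry of \<open>M\<close> can be read off from it.
\<close>
lemma bilinear_form:
  assumes x: "x \<in> carrier_vec (2 * n)" and y: "y \<in> carrier_vec (2 * n)"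
  shows "x \<bullet> (M *\<^sub>v y) = c * (\<Sum>i<n. deviation x (int i) * deviation y (int i)
    + jump x (int i) * jump y (int i) / 12)"
proof -
  define a b p q where "a = iface n x" "b = iface n y" "p = cell n x" "q = cell n y"
  note abpq = this
  have per: "a (i + int n) = a i" "b (i + int n) = b i" "q (i + int n) = q i" for i
    by (simp_all add: abpq iface_periodic cell_periodic)
  define h where "h i = c * (a (i - 1) * (b (i - 2) / 6 - q (i - 1) / 2 + 2 / 3 * b (i - 1)
      - q i / 2 + b i / 6) + p i * (q i - b (i - 1) / 2 - b i / 2))" for i
  \<comment> \<open>\<open>h\<close> is what cell \<open>i\<close> and its left interface contribute to the scalar product. In the claimed
    form, the terms at an interface are shared between both neighbouring cells; \<open>- G i\<close> is the share
    of cell \<open>i\<close> in the terms at its right interface, which \<open>h\<close> counts in cell \<open>i + 1\<close>.\<close>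
  define G where "G i = c * (a i * q i / 2 - a i * b (i - 1) / 6 - a i * b i / 3)" for i
  have "x \<bullet> (M *\<^sub>v y) = (\<Sum>i<n. h (int i))"
    using M y by (subst scalar_prod_grid)
      (auto simp: h_def abpq cell_M iface_M algebra_simps intro!: sum.cong)
  also have "\<dots> = (\<Sum>i<n. c * (deviation x (int i) * deviation y (int i)
    + jump x (int i) * jump y (int i) / 12) + (G (int i) - G (int i - 1)))"
    by (intro sum.cong) (auto simp: h_def G_def deviation_def jump_def abpq field_simps)
  also have "\<dots> = (\<Sum>i<n. c * (deviation x (int i) * deviation y (int i)
    + jump x (int i) * jump y (int i) / 12))"
  proof -
    have "G (i + int n) = G i" for i
      using per(2)[of "i - 1"] by (simp add: G_def per algebra_simps)
    then have "(\<Sum>i<n. G (int i) - G (int i - 1)) = 0" by (rule sum_differences_periodic)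
    then show ?thesis by (simp only: sum.distrib)
  qed
  finally show ?thesis by (simp add: sum_distrib_left)
qed

lemma M_symmetric: "transpose_mat M = M"
proof (rule eq_matI)
  fix i j assume "i < dim_row M" "j < dim_col M"
  then have ij: "i < 2 * n" "j < 2 * n" using M by auto
  have entry: "M $$ (i, j) = unit_vec (2 * n) i \<bullet> (M *\<^sub>v unit_vec (2 * n) j)"
    if "i < 2 * n" "j < 2 * n" for i j
    using that M by simp
  have "M $$ (j, i) = M $$ (i, j)"
    unfolding entry[OF ij] entry[OF ij(2,1)] by (simp add: bilinear_form mult.commute)
  then show "transpose_mat M $$ (i, j) = M $$ (i, j)" using ij M by simp
qed (use M in auto)

lemma quadratic_form:
  assumes "x \<in> carrier_vec (2 * n)"
  shows "x \<bullet> (M *\<^sub>v x) = c * (\<Sum>i<n. (deviation x (int i))\<^sup>2 + (jump x (int i))\<^sup>2 / 12)"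
  using bilinear_form[OF assms assms] by (simp add: power2_eq_square)

lemma M_positive_semidefinite: "positive_semidefinite M"
  using M M_symmetric c_pos
  by (auto simp: positive_semidefinite_def symmetric_matrix_def quadratic_form intro!: mult_nonneg_nonneg sum_nonneg)

lemma ones_carrier: "ones_vec (2 * n) \<in> carrier_vec (2 * n)"
  by (simp add: ones_vec_def)

lemma M_ones: "M *\<^sub>v ones_vec (2 * n) = 0\<^sub>v (2 * n)"
proof -
  have "0\<^sub>v (2 * n) = vec (2 * n) (\<lambda>_. 0 :: real)" by auto
  then show ?thesis
    using M by (intro grid_vec_eqI[where n = n])
      (simp_all add: ones_vec_def cell_M iface_M cell_const iface_const n_pos)
qed

lemma kernel_M:
  assumes x: "x \<in> carrier_vec (2 * n)" and Mx: "M *\<^sub>v x = 0\<^sub>v (2 * n)"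
  shows "\<exists>d. x = d \<cdot>\<^sub>v ones_vec (2 * n)"
proof -
  have "c * (\<Sum>i<n. (deviation x (int i))\<^sup>2 + (jump x (int i))\<^sup>2 / 12) = 0"
    using quadratic_form[OF x] x by (simp add: Mx)
  then have "\<forall>i\<in>{..<n}. (deviation x (int i))\<^sup>2 + (jump x (int i))\<^sup>2 / 12 = 0"
    using c_pos by (subst sum_nonneg_eq_0_iff[symmetric]) auto
  then have zero: "deviation x (int i) = 0" "jump x (int i) = 0" if "i < n" for i
    using that by (auto simp: add_nonneg_eq_0_iff)
  have iface: "iface n x (int i - 1) = x $ 0" if "i \<le> n" for i
    using that
  proof (induction i)
    case 0
    show ?case using iface_entry[of 0 n x] n_pos by simp
  next
    case (Suc i)
    then show ?case using zero(2)[of i] by (simp add: jump_def)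
  qed
  have cell: "cell n x (int i) = x $ 0" if "i < n" for i
    using zero(1)[OF that] iface[of i] iface[of "Suc i"] that by (simp add: deviation_def)
  have "x $ 0 \<cdot>\<^sub>v ones_vec (2 * n) = vec (2 * n) (\<lambda>_. x $ 0)"
    by (auto simp: ones_vec_def)
  then have "x = x $ 0 \<cdot>\<^sub>v ones_vec (2 * n)"
    using x n_pos by (intro grid_vec_eqI[where n = n]) (simp_all add: cell iface cell_const iface_const)
  then show ?thesis ..
qed

lemma eigenvector_ones: "eigenvector M (ones_vec (2 * n)) 0"
proof -
  have "ones_vec (2 * n) $ 0 \<noteq> 0\<^sub>v (2 * n) $ 0" using n_pos by (simp add: ones_vec_def)
  then have "ones_vec (2 * n) \<noteq> 0\<^sub>v (2 * n)" by metis
  moreover have "0 \<cdot>\<^sub>v ones_vec (2 * n) = 0\<^sub>v (2 * n)"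
    by (auto simp: ones_vec_def)
  ultimately show ?thesis
    using M ones_carrier by (simp add: eigenvector_def M_ones)
qed

end

theorem lemma3p9:
  fixes n :: nat and dx m_v :: real and M :: "real mat"
  assumes "n \<ge> 1" and "dx > 0" and "m_v > 0"
    and "M \<in> carrier_mat (2 * n) (2 * n)"
    and "\<And>u i. u \<in> carrier_vec (2 * n) \<Longrightarrow>
      cell n (M *\<^sub>v u) i =
        dx * m_v * (- (1/2) * iface n u (i - 1) + cell n u i - (1/2) * iface n u i)"
    and "\<And>u i. u \<in> carrier_vec (2 * n) \<Longrightarrow>
      iface n (M *\<^sub>v u) i =
        dx * m_v * ((1/6) * iface n u (i - 1) - (1/2) * cell n u i + (2/3) * iface n u i
          - (1/2) * cell n u (i + 1) + (1/6) * iface n u (i + 1))"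
  shows "positive_semidefinite M \<and>
    Polynomial.order 0 (char_poly M) = 1 \<and>
    eigenvector M (ones_vec (2 * n)) 0"
proof -
  interpret periodic_stencil_matrix n "dx * m_v" M
    by unfold_locales (use assms in simp_all)
  have "Polynomial.order 0 (char_poly M) = 1"
    using eigenvector_ones M
    by (intro order_char_poly_symmetric[OF M M_symmetric ones_carrier _ M_ones kernel_M])
      (simp_all add: eigenvector_def)
  then show ?thesis using M_positive_semidefinite eigenvector_ones by simp
qed

end
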